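(* Let $n_1,n_2,m$ be positive integers, let $M_a\in\mathbb{C}^{2n_1\times2n_1}$, $M_b\in\mathbb{C}^{2n_1\times2n_2}$, $M_c\in\mathbb{C}^{2n_2\times2n_1}$, $M_d\in\mathbb{C}^{2n_2\times2n_2}$, $N_a\in\mathbb{C}^{2m\times2n_1}$, $N_b\in\mathbb{C}^{2m\times2n_2}$ be $\varepsilon$-independent matrices of doubled-up form, with blocks denoted $M_a=\begin{bmatrix} M_{1a}&M_{2a}\\ M_{2a}^\#&M_{1a}^\#\end{bmatrix}$ and likewise for the others, and let $S\in\mathbb{C}^{m\times m}$ be unitary. For $\varepsilon>0$ consider the linear quantum system defined by the commutation, Hamiltonian, coupling and scattering data $$\Theta=J,\qquad M=\begin{bmatrix} M_{1a}&\frac1{\sqrt\varepsilon}M_{1b}&M_{2a}&\frac1{\sqrt\varepsilon}M_{2b}\\ \frac1{\sqrt\varepsilon}M_{1c}&\frac1\varepsilon M_{1d}&\frac1{\sqrt\varepsilon}M_{2c}&\frac1\varepsilon M_{2d}\\ M_{2a}^\#&\frac1{\sqrt\varepsilon}M_{2b}^\#&M_{1a}^\#&\frac1{\sqrt\varepsilon}M_{1b}^\#\\ \frac1{\sqrt\varepsilon}M_{2c}^\#&\frac1\varepsilon M_{2d}^\#&\frac1{\sqrt\varepsilon}M_{1c}^\#&\frac1\varepsilon M_{1d}^\# \end{bmatrix}=M^\dagger,$$ $$N=\begin{bmatrix} N_{1a}&\frac1{\sqrt\varepsilon}N_{1b}&N_{2a}&\frac1{\sqrt\varepsilon}N_{2b}\\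 N_{2a}^\#&\frac1{\sqrt\varepsilon}N_{2b}^\#&N_{1a}^\#&\frac1{\sqrt\varepsilon}N_{1b}^\# \end{bmatrix},\qquad K=\begin{bmatrix}S&0\\ 0&S^\#\end{bmatrix},$$ i.e. the system with matrices $F=-i\Theta M-\frac12\Theta N^\dagger JN$, $G=-\Theta N^\dagger JK$, $H=N$, and $K$. Suppose this system is physically realizable for all $\varepsilon>0$, and that $iM_d+\frac12N_b^\dagger JN_b$ is non-singular. Let the corresponding singular perturbation approximate system be given by $$ \begin{aligned} F_0&=-J\big(iM_a+\tfrac12N_a^\dagger JN_a\big)+J\big(iM_b+\tfrac12N_a^\dagger JN_b\big)\big(iM_d+\tfrac12N_b^\dagger JN_b\big)^{-1}\big(iM_c+\tfrac12N_b^\dagger JN_a\big),\\ G_0&=-JN_a^\dagger JK+J\big(iM_b+\tfrac12N_a^\dagger JN_b\big)\big(iM_d+\tfrac12N_b^\dagger JN_b\big)^{-1}N_b^\dagger JK,\\ H_0&=N_a-N_b\big(iM_d+\tfrac12N_b^\dagger JN_b\big)^{-1}\big(iM_c+\tfrac12N_b^\dagger JN_a\big),\\ K_0&=K-N_b\big(iM_d+\tfrac12N_b^\dagger JN_b\big)^{-1}N_b^\dagger JK. \end{aligned} $$ Then the approximate system $(F_0,G_0,H_0,K_0)$ is equivalent to a physically realizable system connected in series with a static Bogoliubov component; that is, there exist a physically realizable linear quantum system $(F',G',H',K')$ and a Bogoliubov matrix $B\in\mathbb{C}^{2m\times2m}$ such that $$F_0=F',\qquad G_0=G'B,\qquad H_0=H',\qquad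 K_0=K'B.$$
   Context: Notation. For a complex matrix $X$, $X^\#$ is the entrywise complex conjugate, $X^T$ the transpose and $X^\dagger=(X^\#)^T$ the conjugate transpose; applied to (vectors of) operators, $(\cdot)^\#$ is the (entrywise) operator adjoint. A matrix is of doubled-up form if it can be partitioned as $\begin{bmatrix} X_1 & X_2\\ X_2^\# & X_1^\#\end{bmatrix}$ with $X_1,X_2$ of equal size. $J=\begin{bmatrix} I&0\\ 0&-I\end{bmatrix}$, with two identity blocks of equal size, the size being determined by context. Linear quantum systems. A linear quantum system is described by quantum stochastic differential equations $$\begin{bmatrix} da\\ da^\#\end{bmatrix}=F\begin{bmatrix} a\\ a^\#\end{bmatrix}dt+G\begin{bmatrix} du\\ du^\#\end{bmatrix},\qquad \begin{bmatrix} dy\\ dy^\#\end{bmatrix}=H\begin{bmatrix} a\\ a^\#\end{bmatrix}dt+K\begin{bmatrix} du\\ du^\#\end{bmatrix},$$ where $a$ is a vector of $n$ linear combinations of annihilation and creation operators of harmonic oscillators, $u$ is the input, $y$ the output, and $F\in\mathbb{C}^{2n\times 2n}$, $G\in\mathbb{C}^{2n\times 2m}$, $H\in\mathbb{C}^{2m\times 2n}$, $K\in\mathbb{C}^{2m\times 2m}$ are of doubled-up form. Such a system is identified with $(F,G,H,K)$. Physical realizability. The system $(F,G,H,K)$ is physically realizable if there exist a commutation matrix $\Theta=\Theta^\dagger=TJT^\dagger$ with $T$ non-singular of doubled-up form, a Hamiltonian matrix $M=M^\dagger\in\mathbb{C}^{2n\times 2n}$ of doubled-up form, a coupling matrix $N\in\mathbb{C}^{2m\times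 2n}$ of doubled-up form, and a unitary scattering matrix $S\in\mathbb{C}^{m\times m}$ such that $$F=-i\Theta M-\tfrac12\Theta N^\dagger JN,\quad G=-\Theta N^\dagger JK,\quad H=N,\quad K=\begin{bmatrix} S&0\\ 0&S^\#\end{bmatrix}.$$ Static Bogoliubov component. This is a component implementing $\begin{bmatrix} dy\\ dy^\#\end{bmatrix}=B\begin{bmatrix} du\\ du^\#\end{bmatrix}$, where the Bogoliubov matrix $B\in\mathbb{C}^{2m\times 2m}$ is of doubled-up form and satisfies $JB^\dagger JB=BJB^\dagger J=I$. In the series connection considered here, the input $u$ first passes through the static Bogoliubov component and the resulting output is the input of the physically realizable system. Approximate system. In the singularly perturbed system the variables are ordered $(a_1,a_2,a_1^\#,a_2^\#)$, with $a_1$ of length $n_1$ and $a_2$ of length $n_2$. After the change of variables $\overline a_2=\frac1{\sqrt\varepsilon}a_2$ the system takes the form $$\begin{aligned}\begin{bmatrix} da_1\\ da_1^\#\end{bmatrix}&=F_a\begin{bmatrix} a_1\\ a_1^\#\end{bmatrix}dt+F_b\begin{bmatrix} \overline a_2\\ \overline a_2^\#\end{bmatrix}dt+G_a\begin{bmatrix} du\\ du^\#\end{bmatrix},\\ \varepsilon\begin{bmatrix} d\overline a_2\\ d\overline a_2^\#\end{bmatrix}&=F_c\begin{bmatrix} a_1\\ a_1^\#\end{bmatrix}dt+F_d\begin{bmatrix} \overline a_2\\ \overline a_2^\#\end{bmatrix}dt+G_b\begin{bmatrix} du\\ du^\#\end{bmatrix},\end{aligned}$$ with output matrices $N_a,N_b,K$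 and $F_d=-J(iM_d+\frac12N_b^\dagger JN_b)$. The approximate system $(F_0,G_0,H_0,K_0)$, with state $(a_1,a_1^\#)$, is obtained by formally setting $\varepsilon=0$ and eliminating $\overline a_2$. *)

theory Defs
  imports "HOL-Analysis.Analysis"
begin

text \<open>
  A complex \<open>p \<times> q\<close> matrix has type \<open>complex ^ 'q ^ 'p\<close>; index types are nonempty, so
  dimensions given by free type variables range over all positive integers. The index set
  of a vector stacked from parts of lengths \<open>p\<close> and \<open>q\<close> is the sum type \<open>'p + 'q\<close>; in particular
  the \<open>2n\<close>-dimensional space of pairs \<open>(a, a\<^sup>#)\<close> is indexed by \<open>'n + 'n\<close>.
\<close>

definition mat_cnj :: "complex ^ 'q ^ 'p \<Rightarrow> complex ^ 'q ^ 'p" (\<open>(\<open>notation=\<open>postfix mat_cnj\<close>\<close>_\<^sup>#)\<close> [1000] 999)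
  where "X\<^sup># = map_matrix cnj X"

definition mat_adj :: "complex ^ 'q ^ 'p \<Rightarrow> complex ^ 'p ^ 'q" (\<open>(\<open>notation=\<open>postfix mat_adj\<close>\<close>_\<^sup>\<dagger>)\<close> [1000] 999)
  where "X\<^sup>\<dagger> = transpose (X\<^sup>#)"

definition mat_cscale :: "complex \<Rightarrow> complex ^ 'q ^ 'p \<Rightarrow> complex ^ 'q ^ 'p" (infixr \<open>*\<^sub>C\<close> 75)
  where "c *\<^sub>C X = map_matrix ((*) c) X"

definition row_block :: "'a ^ 'q1 ^ 'p \<Rightarrow> 'a ^ 'q2 ^ 'p \<Rightarrow> 'a ^ ('q1::finite + 'q2::finite) ^ 'p"
  where "row_block A B =
    (\<chi> i j. case j of Inl j1 \<Rightarrow> A $ i $ j1 | Inr j2 \<Rightarrow> B $ i $ j2)"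

definition block_mat ::
  "'a ^ 'q1 ^ 'p1 \<Rightarrow> 'a ^ 'q2 ^ 'p1 \<Rightarrow> 'a ^ 'q1 ^ 'p2 \<Rightarrow> 'a ^ 'q2 ^ 'p2 \<Rightarrow> 'a ^ ('q1::finite + 'q2::finite) ^ ('p1::finite + 'p2::finite)"
  where "block_mat A B C D =
    (\<chi> i. case i of Inl i1 \<Rightarrow> row_block A B $ i1 | Inr i2 \<Rightarrow> row_block C D $ i2)"

definition doubled_up :: "complex ^ ('q::finite + 'q) ^ ('p::finite + 'p) \<Rightarrow> bool"
  where "doubled_up X \<longleftrightarrow> (\<exists>X1 X2. X = block_mat X1 X2 (X2\<^sup>#) (X1\<^sup>#))"

definition Jmat :: "complex ^ ('n::finite + 'n) ^ ('n + 'n)"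
  where "Jmat = block_mat (mat 1) 0 0 (- mat 1)"

definition unitary_mat :: "complex ^ 'n ^ 'n \<Rightarrow> bool"
  where "unitary_mat S \<longleftrightarrow> S\<^sup>\<dagger> ** S = mat 1 \<and> S ** S\<^sup>\<dagger> = mat 1"

text \<open>
  A linear quantum system with \<open>n\<close> modes and \<open>m\<close> input-output channels is identified with the
  coefficient matrices \<open>(F, G, H, K)\<close> of its quantum stochastic differential equations.
\<close>

definition linear_quantum_system ::
  "complex ^ ('n::finite + 'n) ^ ('n + 'n) \<Rightarrow> complex ^ ('m::finite + 'm) ^ ('n + 'n) \<Rightarrow>
   complex ^ ('n + 'n) ^ ('m + 'm) \<Rightarrow> complex ^ ('m + 'm) ^ ('m + 'm) \<Rightarrow> bool"
  where "linear_quantum_system F G H K \<longleftrightarrow>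
    doubled_up F \<and> doubled_up G \<and> doubled_up H \<and> doubled_up K"

definition physically_realizable ::
  "complex ^ ('n::finite + 'n) ^ ('n + 'n) \<Rightarrow> complex ^ ('m::finite + 'm) ^ ('n + 'n) \<Rightarrow>
   complex ^ ('n + 'n) ^ ('m + 'm) \<Rightarrow> complex ^ ('m + 'm) ^ ('m + 'm) \<Rightarrow> bool"
  where "physically_realizable F G H K \<longleftrightarrow>
    linear_quantum_system F G H K \<and>
    (\<exists>\<Theta> (T :: complex ^ ('n + 'n) ^ ('n + 'n)) M N S.
      \<Theta> = \<Theta>\<^sup>\<dagger> \<and> \<Theta> = T ** Jmat ** T\<^sup>\<dagger> \<and> invertible T \<and> doubled_up T \<and>
      M = M\<^sup>\<dagger> \<and> doubled_up M \<and>
      doubled_up N \<and>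
      unitary_mat S \<and>
      F = - (\<i> *\<^sub>C (\<Theta> ** M)) - (1/2) *\<^sub>R (\<Theta> ** N\<^sup>\<dagger> ** Jmat ** N) \<and>
      G = - (\<Theta> ** N\<^sup>\<dagger> ** Jmat ** K) \<and>
      H = N \<and>
      K = block_mat S 0 0 (S\<^sup>#))"

definition bogoliubov :: "complex ^ ('m::finite + 'm) ^ ('m + 'm) \<Rightarrow> bool"
  where "bogoliubov B \<longleftrightarrow>
    doubled_up B \<and> Jmat ** B\<^sup>\<dagger> ** Jmat ** B = mat 1 \<and> B ** Jmat ** B\<^sup>\<dagger> ** Jmat = mat 1"

end

theory Submission
  imports Defs
begin

text \<open>
  Put \<open>D = \<i>M\<^sub>d + \<onehalf>N\<^sub>b\<^sup>\<dagger>JN\<^sub>b\<close>, \<open>A = \<i>M\<^sub>a + \<onehalf>N\<^sub>a\<^sup>\<dagger>JN\<^sub>a\<close>, \<open>P = \<i>M\<^sub>b + \<onehalf>N\<^sub>a\<^sup>\<dagger>JN\<^sub>b\<close>, \<open>Q = \<i>M\<^sub>c + \<onehalf>N\<^sub>b\<^sup>\<dagger>JN\<^sub>a\<close> and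
  \<open>Z = D\<^sup>-\<^sup>1\<close>. Hermiticity of \<open>M\<close> says that \<open>D + D\<^sup>\<dagger> = N\<^sub>b\<^sup>\<dagger>JN\<^sub>b\<close>, \<open>A + A\<^sup>\<dagger> = N\<^sub>a\<^sup>\<dagger>JN\<^sub>a\<close> and
  \<open>P + Q\<^sup>\<dagger> = N\<^sub>a\<^sup>\<dagger>JN\<^sub>b\<close>. Hence \<open>Z\<^sup>\<dagger>N\<^sub>b\<^sup>\<dagger>JN\<^sub>bZ = Z + Z\<^sup>\<dagger>\<close>, from which one gets, for the Schur complement
  \<open>E = A - PZQ\<close> and \<open>B\<^sub>0 = 1 - N\<^sub>bZN\<^sub>b\<^sup>\<dagger>J\<close>, the identities \<open>B\<^sub>0\<^sup>\<dagger>JB\<^sub>0 = J\<close>, \<open>E + E\<^sup>\<dagger> = H\<^sub>0\<^sup>\<dagger>JH\<^sub>0\<close> and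
  \<open>G\<^sub>0 = -JH\<^sub>0\<^sup>\<dagger>JB\<^sub>0K\<close>. So the Hamiltonian \<open>-\<i>(E - \<onehalf>H\<^sub>0\<^sup>\<dagger>JH\<^sub>0)\<close> with coupling \<open>H\<^sub>0\<close> and trivial
  scattering realizes \<open>F\<^sub>0 = -JE\<close>, and \<open>B = B\<^sub>0K\<close> is the Bogoliubov matrix.
\<close>

section \<open>Entrywise and block matrix algebra\<close>

lemma mat_adj_nth [simp]: "(X\<^sup>\<dagger>) $ i $ j = cnj (X $ j $ i)"
  by (simp add: mat_adj_def mat_cnj_def map_matrix_def transpose_def)

lemma mat_cnj_nth [simp]: "(X\<^sup>#) $ i $ j = cnj (X $ i $ j)"
  by (simp add: mat_cnj_def map_matrix_def)

lemma mat_cscale_nth [simp]: "(c *\<^sub>C X) $ i $ j = c * X $ i $ j"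
  by (simp add: mat_cscale_def map_matrix_def)

lemma row_block_nth [simp]:
  "row_block A B $ i $ Inl j = A $ i $ j"
  "row_block A B $ i $ Inr k = B $ i $ k"
  by (simp_all add: row_block_def)

lemma block_mat_nth [simp]:
  "block_mat A B C D $ Inl i $ Inl j = A $ i $ j"
  "block_mat A B C D $ Inl i $ Inr k = B $ i $ k"
  "block_mat A B C D $ Inr l $ Inl j = C $ l $ j"
  "block_mat A B C D $ Inr l $ Inr k = D $ l $ k"
  by (simp_all add: block_mat_def)

lemma block_mat_eqI:
  assumes "\<And>i j. X $ Inl i $ Inl j = Y $ Inl i $ Inl j"
    and "\<And>i j. X $ Inl i $ Inr j = Y $ Inl i $ Inr j"
    and "\<And>i j. X $ Inr i $ Inl j = Y $ Inr i $ Inl j"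
    and "\<And>i j. X $ Inr i $ Inr j = Y $ Inr i $ Inr j"
  shows "X = (Y :: 'a ^ ('q1::finite + 'q2::finite) ^ ('p1::finite + 'p2::finite))"
  using assms by (auto simp: vec_eq_iff split_sum_all)

lemma sum_UNIV_Plus:
  "sum f (UNIV :: ('p::finite + 'q::finite) set) = (\<Sum>i\<in>UNIV. f (Inl i)) + (\<Sum>j\<in>UNIV. f (Inr j))"
  unfolding UNIV_Plus_UNIV [symmetric] by (subst sum.Plus) auto

lemma block_mat_eq_iff [simp]:
  "block_mat A B C D = block_mat A' B' C' D' \<longleftrightarrow> A = A' \<and> B = B' \<and> C = C' \<and> D = D'"
  by (auto simp: vec_eq_iff split_sum_all)

lemma block_mat_mult:
  "block_mat A B C D ** block_mat A' B' C' D' =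
    block_mat (A ** A' + B ** C') (A ** B' + B ** D') (C ** A' + D ** C') (C ** B' + D ** D')"
  by (rule block_mat_eqI) (simp_all add: matrix_matrix_mult_def sum_UNIV_Plus)

lemma block_mat_adj: "(block_mat A B C D)\<^sup>\<dagger> = block_mat (A\<^sup>\<dagger>) (C\<^sup>\<dagger>) (B\<^sup>\<dagger>) (D\<^sup>\<dagger>)"
  by (rule block_mat_eqI) simp_all

lemma block_mat_one: "block_mat (mat 1) 0 0 (mat 1) = mat 1"
  by (rule block_mat_eqI) (simp_all add: mat_def)

lemma mat_adj_add: "(A + B)\<^sup>\<dagger> = A\<^sup>\<dagger> + B\<^sup>\<dagger>"
  and mat_adj_diff: "(A - B)\<^sup>\<dagger> = A\<^sup>\<dagger> - B\<^sup>\<dagger>"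
  and mat_adj_scaleR: "(r *\<^sub>R A)\<^sup>\<dagger> = r *\<^sub>R A\<^sup>\<dagger>"
  and mat_adj_cscale: "(c *\<^sub>C A)\<^sup>\<dagger> = cnj c *\<^sub>C A\<^sup>\<dagger>"
  and mat_adj_adj: "(A\<^sup>\<dagger>)\<^sup>\<dagger> = A"
  and mat_adj_zero: "0\<^sup>\<dagger> = 0"
  by (simp_all add: vec_eq_iff)

lemma mat_adj_one: "(mat 1)\<^sup>\<dagger> = mat 1"
  by (simp add: vec_eq_iff mat_def)

lemma mat_adj_mult: "(A ** B)\<^sup>\<dagger> = B\<^sup>\<dagger> ** A\<^sup>\<dagger>"
  by (simp add: vec_eq_iff matrix_matrix_mult_def mult.commute)

lemma mat_cnj_mult: "(A ** B)\<^sup># = A\<^sup># ** B\<^sup>#"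
  by (simp add: vec_eq_iff matrix_matrix_mult_def)

lemma mat_cnj_adj: "(A\<^sup>\<dagger>)\<^sup># = (A\<^sup>#)\<^sup>\<dagger>"
  by (simp add: vec_eq_iff)

lemma mat_cnj_zero: "0\<^sup># = 0"
  by (simp add: vec_eq_iff)

lemma mat_cnj_one: "(mat 1)\<^sup># = mat 1"
  by (simp add: vec_eq_iff mat_def)

lemma matrix_mult_uminus_left: "(- A) ** B = - (A ** (B :: 'a::ring_1 ^ 'n ^ 'm))"
  and matrix_mult_uminus_right: "A ** (- B) = - (A ** (B :: 'a::ring_1 ^ 'n ^ 'm))"
  and matrix_add_rdistrib: "(A + C) ** B = A ** B + C ** (B :: 'a::ring_1 ^ 'n ^ 'm)"
  and matrix_mult_diff_left: "(A - C) ** B = A ** B - C ** (B :: 'a::ring_1 ^ 'n ^ 'm)"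
  and matrix_mult_diff_right: "A ** (B - E) = A ** B - A ** (E :: 'a::ring_1 ^ 'n ^ 'm)"
  by (simp_all add: vec_eq_iff matrix_matrix_mult_def sum_negf sum_subtractf sum.distrib algebra_simps)

lemma matrix_mult_scaleR_right: "A ** (r *\<^sub>R B) = r *\<^sub>R (A ** (B :: complex ^ 'n ^ 'm))"
  and matrix_mult_cscale_right: "A ** (c *\<^sub>C B) = c *\<^sub>C (A ** (B :: complex ^ 'n ^ 'm))"
  by (simp_all add: vec_eq_iff matrix_matrix_mult_def scaleR_sum_right sum_distrib_left algebra_simps)

lemmas matrix_expand_simps =
  matrix_add_ldistrib matrix_add_rdistrib matrix_mult_uminus_left matrix_mult_uminus_right
  matrix_mult_diff_left matrix_mult_diff_right mat_adj_add mat_adj_diff mat_adj_mult mat_adj_adj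

text \<open>In right-associated products a pair \<open>A ** B\<close> is visible only through the
  tail that follows it, so the rewrite rule has to carry \<open>X\<close>.\<close>

lemma matrix_mult_cancel_inner:
  assumes "A ** B = mat 1"
  shows "A ** (B ** X) = X"
  using assms by (simp add: matrix_mul_assoc)

lemma matrix_mult_assoc3:
  assumes "A ** B ** C = D"
  shows "A ** (B ** (C ** X)) = D ** X"
  using assms by (simp add: matrix_mul_assoc)

lemma Jmat_adj: "Jmat\<^sup>\<dagger> = Jmat"
  unfolding Jmat_def block_mat_adj by (simp add: vec_eq_iff mat_def split_sum_all)

lemma Jmat_square: "Jmat ** Jmat = mat 1"
  unfolding Jmat_def block_mat_mult
  by (simp add: matrix_mult_uminus_left matrix_mult_uminus_right block_mat_one)

section \<open>Doubled-up form as a fixed-point condition\<close>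

text \<open>
  The doubled-up matrices are the fixed points of this involution. It is multiplicative but negates
  \<open>\<i>\<close> and \<open>J\<close>, so matrices such as \<open>D\<close>, which are not doubled-up, are negated by it, as are their
  inverses; closure of the doubled-up form then becomes a matter of counting signs.
\<close>

definition swap_conj :: "complex ^ ('q::finite + 'q) ^ ('p::finite + 'p) \<Rightarrow> complex ^ ('q + 'q) ^ ('p + 'p)"
  where "swap_conj X = (\<chi> i j. cnj (X $ case_sum Inr Inl i $ case_sum Inr Inl j))"

lemma swap_conj_nth [simp]: "swap_conj X $ i $ j = cnj (X $ case_sum Inr Inl i $ case_sum Inr Inl j)"
  by (simp add: swap_conj_def)

lemma doubled_up_iff_swap_conj: "doubled_up X \<longleftrightarrow> swap_conj X = X"
proof
  assume "doubled_up X"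
  then show "swap_conj X = X"
    by (auto simp: doubled_up_def vec_eq_iff split_sum_all)
next
  assume X: "swap_conj X = X"
  let ?X1 = "\<chi> i j. X $ Inl i $ Inl j" and ?X2 = "\<chi> i j. X $ Inl i $ Inr j"
  have "X = block_mat ?X1 ?X2 (?X2\<^sup>#) (?X1\<^sup>#)"
    using X by (intro block_mat_eqI) (auto simp: vec_eq_iff split_sum_all)
  then show "doubled_up X"
    unfolding doubled_up_def by blast
qed

lemma swap_conj_add: "swap_conj (A + B) = swap_conj A + swap_conj B"
  and swap_conj_diff: "swap_conj (A - B) = swap_conj A - swap_conj B"
  and swap_conj_uminus: "swap_conj (- A) = - swap_conj A"
  and swap_conj_scaleR: "swap_conj (r *\<^sub>R A) = r *\<^sub>R swap_conj A"
  and swap_conj_cscale: "swap_conj (c *\<^sub>C A) = cnj c *\<^sub>C swap_conj A"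
  and swap_conj_adj: "swap_conj (A\<^sup>\<dagger>) = (swap_conj A)\<^sup>\<dagger>"
  by (simp_all add: vec_eq_iff)

lemma swap_conj_mult: "swap_conj (A ** B) = swap_conj A ** swap_conj B"
  by (simp add: vec_eq_iff matrix_matrix_mult_def sum_UNIV_Plus add.commute)

lemma swap_conj_one: "swap_conj (mat 1) = mat 1"
  by (simp add: vec_eq_iff mat_def split_sum_all)

lemma swap_conj_Jmat: "swap_conj Jmat = - Jmat"
  by (simp add: Jmat_def vec_eq_iff mat_def split_sum_all)

lemmas swap_conj_simps = swap_conj_add swap_conj_diff swap_conj_uminus swap_conj_scaleR
  swap_conj_cscale swap_conj_adj swap_conj_mult swap_conj_one swap_conj_Jmat
  matrix_mult_uminus_left matrix_mult_uminus_right

lemma cscale_cscale: "c *\<^sub>C d *\<^sub>C A = (c * d) *\<^sub>C A"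
  and cscale_one: "1 *\<^sub>C A = A"
  by (simp_all add: vec_eq_iff)

section \<open>Inverses and preservation of \<open>Jmat\<close>\<close>

lemma matrix_inv_inverts:
  assumes "invertible A"
  shows "A ** matrix_inv A = mat 1" "matrix_inv A ** A = mat 1"
  using someI_ex [OF assms [unfolded invertible_def]] by (simp_all add: matrix_inv_def)

text \<open>Applying \<open>swap_conj\<close> to \<open>D ** Z = mat 1\<close> makes
  \<open>- swap_conj Z\<close> another right inverse of \<open>D\<close>; it equals \<open>Z\<close>
  because \<open>Z\<close> is also a left inverse.\<close>

lemma swap_conj_inverse:
  fixes D Z :: "complex ^ ('n::finite + 'n) ^ ('n + 'n)"
  assumes D: "swap_conj D = - D" and DZ: "D ** Z = mat 1"
  shows "swap_conj Z = - Z"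
proof -
  have ZD: "Z ** D = mat 1"
    using DZ by (simp add: matrix_left_right_inverse)
  have "D ** swap_conj Z = - mat 1"
    using arg_cong [OF DZ, of swap_conj] D
    by (simp add: swap_conj_simps minus_equation_iff eq_commute)
  then have "Z ** (D ** swap_conj Z) = - Z"
    by (simp add: matrix_mult_uminus_right)
  then show ?thesis
    by (simp add: matrix_mult_cancel_inner [OF ZD])
qed

text \<open>One identity suffices: it makes \<open>Jmat ** B\<^sup>\<dagger> ** Jmat\<close> a left
  inverse of the square matrix \<open>B\<close>, hence also a right inverse.\<close>

lemma bogoliubovI:
  assumes "doubled_up B" and B: "B\<^sup>\<dagger> ** Jmat ** B = Jmat"
  shows "bogoliubov B"
proof -
  have "Jmat ** B\<^sup>\<dagger> ** Jmat ** B = mat 1"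
    using B by (simp add: matrix_mul_assoc [symmetric] Jmat_square)
  moreover from this have "B ** (Jmat ** B\<^sup>\<dagger> ** Jmat) = mat 1"
    by (simp add: matrix_left_right_inverse)
  ultimately show ?thesis
    using assms(1) by (simp add: bogoliubov_def matrix_mul_assoc)
qed

lemma unitary_block_preserves_Jmat:
  assumes "unitary_mat S" and "K = block_mat S 0 0 (S\<^sup>#)"
  shows "K\<^sup>\<dagger> ** Jmat ** K = Jmat"
proof -
  have S: "S\<^sup>\<dagger> ** S = mat 1"
    using assms(1) by (simp add: unitary_mat_def)
  have "(S\<^sup>#)\<^sup>\<dagger> ** S\<^sup># = mat 1"
    using arg_cong [OF S, of mat_cnj] by (simp add: mat_cnj_mult mat_cnj_adj mat_cnj_one)
  with S show ?thesis
    by (simp add: assms(2) Jmat_def block_mat_adj block_mat_mult mat_adj_zero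
        matrix_mult_uminus_left matrix_mult_uminus_right)
qed

section \<open>Elimination identities and realization\<close>

text \<open>
  The adjoint of \<open>D Z = 1\<close> turns \<open>D + D\<^sup>\<dagger> = R\<^sup>\<dagger> W R\<close> into this cancellation rule, which makes all
  quadratic terms below collapse.
\<close>

lemma inverse_sandwich:
  assumes D: "D + D\<^sup>\<dagger> = R\<^sup>\<dagger> ** W ** R" and DZ: "D ** Z = mat 1"
  shows "Z\<^sup>\<dagger> ** (R\<^sup>\<dagger> ** (W ** (R ** (Z ** X)))) = Z\<^sup>\<dagger> ** X + Z ** X"
proof -
  have ZD: "Z\<^sup>\<dagger> ** D\<^sup>\<dagger> = mat 1"
    using arg_cong [OF DZ, of mat_adj] by (simp add: mat_adj_mult mat_adj_one)
  have "R\<^sup>\<dagger> ** (W ** (R ** (Z ** X))) = (D + D\<^sup>\<dagger>) ** (Z ** X)"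
    by (simp add: D matrix_mul_assoc)
  then show ?thesis
    by (simp add: matrix_add_ldistrib matrix_add_rdistrib
        matrix_mult_cancel_inner [OF DZ] matrix_mult_cancel_inner [OF ZD])
qed

text \<open>The sandwich rule turns the quadratic term into
  \<open>W ** R ** (Z + Z\<^sup>\<dagger>) ** R\<^sup>\<dagger> ** W\<close>, which cancels the two
  linear terms.\<close>

lemma eliminated_scattering_preserves_form:
  assumes D: "D + D\<^sup>\<dagger> = R\<^sup>\<dagger> ** W ** R" and DZ: "D ** Z = mat 1" and W: "W\<^sup>\<dagger> = W"
    and B: "B = mat 1 - R ** Z ** R\<^sup>\<dagger> ** W"
  shows "B\<^sup>\<dagger> ** W ** B = W"
  unfolding B
  by (simp add: matrix_expand_simps mat_adj_one W matrix_mul_assoc [symmetric]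
      inverse_sandwich [OF D DZ])

text \<open>This lets the input matrix factor through \<open>B\<close>. Replacing
  \<open>L\<^sup>\<dagger> ** W ** R\<close> by \<open>P + Q\<^sup>\<dagger>\<close> and applying
  the sandwich rule cancels every term in \<open>Q\<^sup>\<dagger>\<close>, so only \<open>P\<close>
  survives.\<close>

lemma eliminated_coupling_mult_scattering:
  assumes D: "D + D\<^sup>\<dagger> = R\<^sup>\<dagger> ** W ** R" and DZ: "D ** Z = mat 1"
    and P: "P + Q\<^sup>\<dagger> = L\<^sup>\<dagger> ** W ** R"
    and H: "H = L - R ** Z ** Q" and B: "B = mat 1 - R ** Z ** R\<^sup>\<dagger> ** W"
  shows "H\<^sup>\<dagger> ** W ** B = L\<^sup>\<dagger> ** W - P ** Z ** R\<^sup>\<dagger> ** W"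
  unfolding H B
  by (simp add: matrix_expand_simps matrix_mul_assoc [symmetric] inverse_sandwich [OF D DZ]
      matrix_mult_assoc3 [OF P [symmetric]])

text \<open>Expanding the right side and eliminating \<open>W\<close> by the hypotheses, the terms
  with both \<open>Q\<^sup>\<dagger>\<close> and \<open>Q\<close> cancel; what remains is
  \<open>A - P ** Z ** Q\<close> plus its adjoint.\<close>

lemma eliminated_drift_add_adj:
  assumes D: "D + D\<^sup>\<dagger> = R\<^sup>\<dagger> ** W ** R" and DZ: "D ** Z = mat 1" and W: "W\<^sup>\<dagger> = W"
    and A: "A + A\<^sup>\<dagger> = L\<^sup>\<dagger> ** W ** L" and P: "P + Q\<^sup>\<dagger> = L\<^sup>\<dagger> ** W ** R"
    and E: "E = A - P ** Z ** Q" and H: "H = L - R ** Z ** Q"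
  shows "E + E\<^sup>\<dagger> = H\<^sup>\<dagger> ** W ** H"
proof -
  have 1: "R\<^sup>\<dagger> ** (W ** L) = P\<^sup>\<dagger> + Q"
    using arg_cong [OF P, of mat_adj]
    by (simp add: mat_adj_add mat_adj_mult mat_adj_adj W matrix_mul_assoc)
  have 2: "L\<^sup>\<dagger> ** (W ** L) = A + A\<^sup>\<dagger>"
    by (simp add: A matrix_mul_assoc)
  show ?thesis
    unfolding E H
    by (simp add: matrix_expand_simps matrix_mul_assoc [symmetric] inverse_sandwich [OF D DZ]
        matrix_mult_assoc3 [OF P [symmetric]] matrix_mult_assoc3 [OF 1 [unfolded matrix_mul_assoc]]
        1 2)
qed

text \<open>The identity \<open>EE\<close> fixes the Hermitian part of \<open>E\<close> as half of
  \<open>H\<^sup>\<dagger> ** Jmat ** H\<close>. The remainder is skew-Hermitian, so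
  \<open>- \<i>\<close> times it can serve as Hamiltonian; conjugating \<open>\<i>\<close> offsets
  the sign that \<open>swap_conj\<close> gives to \<open>E\<close>.\<close>

lemma physically_realizable_unit_scattering:
  fixes E :: "complex ^ ('n::finite + 'n) ^ ('n + 'n)"
    and H :: "complex ^ ('n + 'n) ^ ('m::finite + 'm)"
  assumes E: "swap_conj E = - E" and H: "swap_conj H = H"
    and EE: "E + E\<^sup>\<dagger> = H\<^sup>\<dagger> ** Jmat ** H"
  shows "physically_realizable (- (Jmat ** E)) (- (Jmat ** H\<^sup>\<dagger> ** Jmat)) H (mat 1)"
proof -
  define X where "X = H\<^sup>\<dagger> ** Jmat ** H"
  define M where "M = (- \<i>) *\<^sub>C (E - (1/2) *\<^sub>R X)"
  have X_adj: "X\<^sup>\<dagger> = X"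
    by (simp add: X_def mat_adj_mult mat_adj_adj Jmat_adj matrix_mul_assoc)
  have X_swap: "swap_conj X = - X"
    by (simp add: X_def swap_conj_simps H)
  have M_adj: "M = M\<^sup>\<dagger>"
  proof -
    have E_adj: "E\<^sup>\<dagger> = X - E"
      using EE by (simp add: X_def algebra_simps)
    show ?thesis
      by (simp add: M_def mat_adj_cscale mat_adj_diff mat_adj_scaleR X_adj E_adj)
        (simp add: vec_eq_iff complex_eq_iff algebra_simps)
  qed
  have M_swap: "swap_conj M = M"
    by (simp add: M_def swap_conj_simps E X_swap) (simp add: vec_eq_iff algebra_simps)
  have "\<i> *\<^sub>C M = E - (1/2) *\<^sub>R X"
    by (simp add: M_def cscale_cscale cscale_one)
  then have drift: "- (Jmat ** E) = - (\<i> *\<^sub>C (Jmat ** M)) - (1/2) *\<^sub>R (Jmat ** H\<^sup>\<dagger> ** Jmat ** H)"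
    by (simp add: matrix_mult_cscale_right [symmetric] matrix_mult_diff_right
        matrix_mult_scaleR_right X_def matrix_mul_assoc)
  have "linear_quantum_system (- (Jmat ** E)) (- (Jmat ** H\<^sup>\<dagger> ** Jmat)) H (mat 1)"
    by (simp add: linear_quantum_system_def doubled_up_iff_swap_conj swap_conj_simps E H)
  then show ?thesis
    unfolding physically_realizable_def
  proof
    have inv: "invertible (mat 1 :: complex ^ ('n + 'n) ^ ('n + 'n))"
      by (auto simp: invertible_def)
    show "\<exists>\<Theta> (T :: complex ^ ('n + 'n) ^ ('n + 'n)) M N S.
        \<Theta> = \<Theta>\<^sup>\<dagger> \<and> \<Theta> = T ** Jmat ** T\<^sup>\<dagger> \<and> invertible T \<and> doubled_up T \<and>
        M = M\<^sup>\<dagger> \<and> doubled_up M \<and> doubled_up N \<and> unitary_mat S \<and>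
        - (Jmat ** E) = - (\<i> *\<^sub>C (\<Theta> ** M)) - (1/2) *\<^sub>R (\<Theta> ** N\<^sup>\<dagger> ** Jmat ** N) \<and>
        - (Jmat ** H\<^sup>\<dagger> ** Jmat) = - (\<Theta> ** N\<^sup>\<dagger> ** Jmat ** mat 1) \<and>
        H = N \<and> mat 1 = block_mat S 0 0 (S\<^sup>#)"
      \<comment> \<open>Canonical commutation relations: \<Theta> is \<open>Jmat\<close> with
        \<open>T = mat 1\<close>; the coupling is \<open>H\<close> and the scattering is the
        identity.\<close>
      by (rule exI [where x = Jmat], rule exI [where x = "mat 1"], rule exI [where x = M],
          rule exI [where x = H], rule exI [where x = "mat 1"])
        (simp add: Jmat_adj mat_adj_one mat_cnj_one block_mat_one unitary_mat_def swap_conj_one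
          doubled_up_iff_swap_conj M_adj [symmetric] M_swap H inv drift)
  qed
qed

text \<open>The Hamiltonian parts cancel because \<open>\<i>\<close> is conjugated, and the two
  halves add up. Separate \<open>L\<close> and \<open>R\<close> cover the off-diagonal pair
  \<open>P\<close>, \<open>Q\<close> along with \<open>A\<close> and \<open>D\<close>.\<close>

lemma coupled_hamiltonian_add_adj:
  assumes "M' = M\<^sup>\<dagger>" and "W\<^sup>\<dagger> = W"
  shows "(\<i> *\<^sub>C M + (1/2) *\<^sub>R (L\<^sup>\<dagger> ** W ** R)) + (\<i> *\<^sub>C M' + (1/2) *\<^sub>R (R\<^sup>\<dagger> ** W ** L))\<^sup>\<dagger>
    = L\<^sup>\<dagger> ** W ** R"
proof -
  have "(R\<^sup>\<dagger> ** W ** L)\<^sup>\<dagger> = L\<^sup>\<dagger> ** W ** R"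
    by (simp add: mat_adj_mult mat_adj_adj assms(2) matrix_mul_assoc)
  then show ?thesis
    by (simp add: assms(1) mat_adj_add mat_adj_cscale mat_adj_scaleR mat_adj_adj)
      (simp add: vec_eq_iff)
qed

text \<open>Both summands change sign: one contains a single \<open>\<i>\<close>, the other a single
  \<open>Jmat\<close>.\<close>

lemma swap_conj_coupled_hamiltonian:
  assumes "swap_conj M = M" "swap_conj L = L" "swap_conj R = R"
  shows "swap_conj (\<i> *\<^sub>C M + (1/2) *\<^sub>R (L\<^sup>\<dagger> ** Jmat ** R))
    = - (\<i> *\<^sub>C M + (1/2) *\<^sub>R (L\<^sup>\<dagger> ** Jmat ** R))"
  by (simp add: swap_conj_simps assms) (simp add: vec_eq_iff)

section \<open>The approximate system\<close>

theorem theorem3: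
  fixes M1a M2a :: "complex ^ 'n1::finite ^ 'n1"
    and M1b M2b :: "complex ^ 'n2::finite ^ 'n1"
    and M1c M2c :: "complex ^ 'n1 ^ 'n2"
    and M1d M2d :: "complex ^ 'n2 ^ 'n2"
    and N1a N2a :: "complex ^ 'n1 ^ 'm::finite"
    and N1b N2b :: "complex ^ 'n2 ^ 'm"
    and S :: "complex ^ 'm ^ 'm"
    and Ma :: "complex ^ ('n1 + 'n1) ^ ('n1 + 'n1)"
    and Mb :: "complex ^ ('n2 + 'n2) ^ ('n1 + 'n1)"
    and Mc :: "complex ^ ('n1 + 'n1) ^ ('n2 + 'n2)"
    and Md :: "complex ^ ('n2 + 'n2) ^ ('n2 + 'n2)"
    and Na :: "complex ^ ('n1 + 'n1) ^ ('m + 'm)"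
    and Nb :: "complex ^ ('n2 + 'n2) ^ ('m + 'm)"
    and K K0 :: "complex ^ ('m + 'm) ^ ('m + 'm)"
    and \<Theta> :: "complex ^ (('n1 + 'n2) + ('n1 + 'n2)) ^ (('n1 + 'n2) + ('n1 + 'n2))"
    and M F :: "real \<Rightarrow> complex ^ (('n1 + 'n2) + ('n1 + 'n2)) ^ (('n1 + 'n2) + ('n1 + 'n2))"
    and N H :: "real \<Rightarrow> complex ^ (('n1 + 'n2) + ('n1 + 'n2)) ^ ('m + 'm)"
    and G :: "real \<Rightarrow> complex ^ ('m + 'm) ^ (('n1 + 'n2) + ('n1 + 'n2))"
    and F0 :: "complex ^ ('n1 + 'n1) ^ ('n1 + 'n1)"
    and G0 :: "complex ^ ('m + 'm) ^ ('n1 + 'n1)"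
    and H0 :: "complex ^ ('n1 + 'n1) ^ ('m + 'm)"
  assumes Ma: "Ma = block_mat M1a M2a (M2a\<^sup>#) (M1a\<^sup>#)"
    and Mb: "Mb = block_mat M1b M2b (M2b\<^sup>#) (M1b\<^sup>#)"
    and Mc: "Mc = block_mat M1c M2c (M2c\<^sup>#) (M1c\<^sup>#)"
    and Md: "Md = block_mat M1d M2d (M2d\<^sup>#) (M1d\<^sup>#)"
    and Na: "Na = block_mat N1a N2a (N2a\<^sup>#) (N1a\<^sup>#)"
    and Nb: "Nb = block_mat N1b N2b (N2b\<^sup>#) (N1b\<^sup>#)"
    and S: "unitary_mat S"
    and \<Theta>: "\<Theta> = Jmat"
    and M: "\<And>\<epsilon>. \<epsilon> > 0 \<Longrightarrow> M \<epsilon> = block_mat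
        (block_mat M1a ((1 / sqrt \<epsilon>) *\<^sub>R M1b)
                   ((1 / sqrt \<epsilon>) *\<^sub>R M1c) ((1 / \<epsilon>) *\<^sub>R M1d))
        (block_mat M2a ((1 / sqrt \<epsilon>) *\<^sub>R M2b)
                   ((1 / sqrt \<epsilon>) *\<^sub>R M2c) ((1 / \<epsilon>) *\<^sub>R M2d))
        (block_mat (M2a\<^sup>#) ((1 / sqrt \<epsilon>) *\<^sub>R M2b\<^sup>#)
                   ((1 / sqrt \<epsilon>) *\<^sub>R M2c\<^sup>#) ((1 / \<epsilon>) *\<^sub>R M2d\<^sup>#))
        (block_mat (M1a\<^sup>#) ((1 / sqrt \<epsilon>) *\<^sub>R M1b\<^sup>#)
                   ((1 / sqrt \<epsilon>) *\<^sub>R M1c\<^sup>#) ((1 / \<epsilon>) *\<^sub>R M1d\<^sup>#))"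
    and M_hermitian: "\<And>\<epsilon>. \<epsilon> > 0 \<Longrightarrow> M \<epsilon> = (M \<epsilon>)\<^sup>\<dagger>"
    and N: "\<And>\<epsilon>. \<epsilon> > 0 \<Longrightarrow> N \<epsilon> = block_mat
        (row_block N1a ((1 / sqrt \<epsilon>) *\<^sub>R N1b)) (row_block N2a ((1 / sqrt \<epsilon>) *\<^sub>R N2b))
        (row_block (N2a\<^sup>#) ((1 / sqrt \<epsilon>) *\<^sub>R N2b\<^sup>#)) (row_block (N1a\<^sup>#) ((1 / sqrt \<epsilon>) *\<^sub>R N1b\<^sup>#))"
    and K: "K = block_mat S 0 0 (S\<^sup>#)"
    and F: "\<And>\<epsilon>. \<epsilon> > 0 \<Longrightarrow>
        F \<epsilon> = - (\<i> *\<^sub>C (\<Theta> ** M \<epsilon>)) - (1/2) *\<^sub>R (\<Theta> ** (N \<epsilon>)\<^sup>\<dagger> ** Jmat ** N \<epsilon>)"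
    and G: "\<And>\<epsilon>. \<epsilon> > 0 \<Longrightarrow> G \<epsilon> = - (\<Theta> ** (N \<epsilon>)\<^sup>\<dagger> ** Jmat ** K)"
    and H: "\<And>\<epsilon>. \<epsilon> > 0 \<Longrightarrow> H \<epsilon> = N \<epsilon>"
    and realizable: "\<And>\<epsilon>. \<epsilon> > 0 \<Longrightarrow> physically_realizable (F \<epsilon>) (G \<epsilon>) (H \<epsilon>) K"
    and nonsingular: "invertible (\<i> *\<^sub>C Md + (1/2) *\<^sub>R (Nb\<^sup>\<dagger> ** Jmat ** Nb))"
    and F0: "F0 =
        - (Jmat ** (\<i> *\<^sub>C Ma + (1/2) *\<^sub>R (Na\<^sup>\<dagger> ** Jmat ** Na)))
        + Jmat ** (\<i> *\<^sub>C Mb + (1/2) *\<^sub>R (Na\<^sup>\<dagger> ** Jmat ** Nb))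
            ** matrix_inv (\<i> *\<^sub>C Md + (1/2) *\<^sub>R (Nb\<^sup>\<dagger> ** Jmat ** Nb))
            ** (\<i> *\<^sub>C Mc + (1/2) *\<^sub>R (Nb\<^sup>\<dagger> ** Jmat ** Na))"
    and G0: "G0 =
        - (Jmat ** Na\<^sup>\<dagger> ** Jmat ** K)
        + Jmat ** (\<i> *\<^sub>C Mb + (1/2) *\<^sub>R (Na\<^sup>\<dagger> ** Jmat ** Nb))
            ** matrix_inv (\<i> *\<^sub>C Md + (1/2) *\<^sub>R (Nb\<^sup>\<dagger> ** Jmat ** Nb))
            ** Nb\<^sup>\<dagger> ** Jmat ** K"
    and H0: "H0 =
        Na - Nb ** matrix_inv (\<i> *\<^sub>C Md + (1/2) *\<^sub>R (Nb\<^sup>\<dagger> ** Jmat ** Nb))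
            ** (\<i> *\<^sub>C Mc + (1/2) *\<^sub>R (Nb\<^sup>\<dagger> ** Jmat ** Na))"
    and K0: "K0 =
        K - Nb ** matrix_inv (\<i> *\<^sub>C Md + (1/2) *\<^sub>R (Nb\<^sup>\<dagger> ** Jmat ** Nb))
            ** Nb\<^sup>\<dagger> ** Jmat ** K"
  shows "\<exists>F' G' H' K' B. physically_realizable F' G' H' K' \<and> bogoliubov B \<and>
    F0 = F' \<and> G0 = G' ** B \<and> H0 = H' \<and> K0 = K' ** B"
proof -
  define A where "A = \<i> *\<^sub>C Ma + (1/2) *\<^sub>R (Na\<^sup>\<dagger> ** Jmat ** Na)"
  define P where "P = \<i> *\<^sub>C Mb + (1/2) *\<^sub>R (Na\<^sup>\<dagger> ** Jmat ** Nb)"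
  define Q where "Q = \<i> *\<^sub>C Mc + (1/2) *\<^sub>R (Nb\<^sup>\<dagger> ** Jmat ** Na)"
  define D where "D = \<i> *\<^sub>C Md + (1/2) *\<^sub>R (Nb\<^sup>\<dagger> ** Jmat ** Nb)"
  define Z where "Z = matrix_inv D"
  define E where "E = A - P ** Z ** Q"
  define B0 where "B0 = mat 1 - Nb ** Z ** Nb\<^sup>\<dagger> ** Jmat"
  have DZ: "D ** Z = mat 1"
    unfolding Z_def using nonsingular by (intro matrix_inv_inverts) (simp add: D_def)
  have H0_eq: "H0 = Na - Nb ** Z ** Q"
    by (simp add: H0 Z_def D_def Q_def)

  \<comment> \<open>At \<epsilon> = 1 all scale factors become 1, and comparing the blocks of the
    interleaved matrix yields the relations between \<open>Ma\<close>, \<open>Mb\<close>,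
    \<open>Mc\<close> and \<open>Md\<close>.\<close>
  have "M 1 = (M 1)\<^sup>\<dagger>"
    using M_hermitian by simp
  then have "Ma = Ma\<^sup>\<dagger>" "Mc = Mb\<^sup>\<dagger>" "Md = Md\<^sup>\<dagger>"
    unfolding M [OF zero_less_one] Ma Mb Mc Md block_mat_adj block_mat_eq_iff
      real_sqrt_one div_by_1 scaleR_one
    by blast+
  then have AA: "A + A\<^sup>\<dagger> = Na\<^sup>\<dagger> ** Jmat ** Na"
    and DD: "D + D\<^sup>\<dagger> = Nb\<^sup>\<dagger> ** Jmat ** Nb"
    and PQ: "P + Q\<^sup>\<dagger> = Na\<^sup>\<dagger> ** Jmat ** Nb"
    unfolding A_def D_def P_def Q_def by (intro coupled_hamiltonian_add_adj Jmat_adj; simp)+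

  have "doubled_up Ma" "doubled_up Mb" "doubled_up Mc" "doubled_up Md"
    "doubled_up Na" "doubled_up Nb" "doubled_up K"
    unfolding doubled_up_def Ma Mb Mc Md Na Nb K block_mat_eq_iff using mat_cnj_zero by metis+
  then have swap: "swap_conj Ma = Ma" "swap_conj Mb = Mb" "swap_conj Mc = Mc" "swap_conj Md = Md"
    "swap_conj Na = Na" "swap_conj Nb = Nb" "swap_conj K = K"
    by (simp_all add: doubled_up_iff_swap_conj)
  then have swap': "swap_conj A = - A" "swap_conj P = - P" "swap_conj Q = - Q" "swap_conj D = - D"
    unfolding A_def P_def Q_def D_def by (simp_all only: swap_conj_coupled_hamiltonian)
  have swap_Z: "swap_conj Z = - Z"
    by (rule swap_conj_inverse [OF swap'(4) DZ])

  have "physically_realizable (- (Jmat ** E)) (- (Jmat ** H0\<^sup>\<dagger> ** Jmat)) H0 (mat 1)"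
  proof (rule physically_realizable_unit_scattering)
    \<comment> \<open>Sign count: \<open>P ** Z ** Q\<close> has three negated factors,
      \<open>Nb ** Z ** Q\<close> only two.\<close>
    show "swap_conj E = - E" "swap_conj H0 = H0"
      by (simp_all add: E_def H0_eq swap_conj_simps swap swap' swap_Z)
    show "E + E\<^sup>\<dagger> = H0\<^sup>\<dagger> ** Jmat ** H0"
      by (rule eliminated_drift_add_adj [OF DD DZ Jmat_adj AA PQ E_def H0_eq])
  qed
  moreover have "bogoliubov (B0 ** K)"
  proof (rule bogoliubovI)
    \<comment> \<open>In \<open>B0\<close> the signs of \<open>Z\<close> and \<open>Jmat\<close>
      cancel.\<close>
    show "doubled_up (B0 ** K)"
      by (simp add: doubled_up_iff_swap_conj B0_def swap_conj_simps swap swap_Z)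
    have "(B0 ** K)\<^sup>\<dagger> ** Jmat ** (B0 ** K) = K\<^sup>\<dagger> ** (B0\<^sup>\<dagger> ** Jmat ** B0) ** K"
      by (simp add: mat_adj_mult matrix_mul_assoc)
    then show "(B0 ** K)\<^sup>\<dagger> ** Jmat ** (B0 ** K) = Jmat"
      by (simp add: eliminated_scattering_preserves_form [OF DD DZ Jmat_adj B0_def]
          unitary_block_preserves_Jmat [OF S K])
  qed
  moreover have "F0 = - (Jmat ** E)"
    by (simp add: F0 E_def matrix_mult_diff_right matrix_mul_assoc
        A_def [symmetric] P_def [symmetric] Q_def [symmetric] D_def [symmetric] Z_def [symmetric])
  moreover have "G0 = - (Jmat ** H0\<^sup>\<dagger> ** Jmat) ** (B0 ** K)"
  proof -
    \<comment> \<open>Regrouping exposes \<open>H0\<^sup>\<dagger> ** Jmat ** B0\<close>, the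
      product that collapses to an expression in \<open>P\<close> and \<open>Z\<close>.\<close>
    have "- (Jmat ** H0\<^sup>\<dagger> ** Jmat) ** (B0 ** K) = - (Jmat ** (H0\<^sup>\<dagger> ** Jmat ** B0) ** K)"
      by (simp add: matrix_mult_uminus_left matrix_mul_assoc)
    also have "\<dots> = - (Jmat ** (Na\<^sup>\<dagger> ** Jmat - P ** Z ** Nb\<^sup>\<dagger> ** Jmat) ** K)"
      by (simp only: eliminated_coupling_mult_scattering [OF DD DZ PQ H0_eq B0_def])
    finally show ?thesis
      by (simp add: G0 P_def D_def Z_def matrix_mult_diff_right matrix_mult_diff_left
          matrix_mul_assoc)
  qed
  moreover have "K0 = mat 1 ** (B0 ** K)"
    by (simp add: K0 B0_def D_def Z_def matrix_mult_diff_left)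
  ultimately show ?thesis
    by blast
qed

end
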